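(* Suppose $k=n^c$ for some constant $c\in(0,1)$. Then, for any $\omega=\omega(n)\gg1$, as $n\to\infty$, $$\mathbb{P}\big[\mathrm{comp}_{\max}(\mathbf{C}_{n,p})\ge k\big]\to\begin{cases}0,&\text{if } q=k^{-1}(\log n+\omega),\\ 1,&\text{if } q=k^{-1}\big((1-c)\log n-\omega\big),\end{cases}$$ and $$\mathbb{P}\big[\mathrm{gap}_{\max}(\mathbf{C}_{n,p})\ge k\big]\to\begin{cases}1,&\text{if } p=k^{-1}\big((1-c)\log n-\omega\big),\\ 0,&\text{if } p=k^{-1}(\log n+\omega).\end{cases}$$
   Context: An $n$-composition is a sequence of $n$ nonnegative integers. For $p=p(n)\in[0,1)$ and $q=1-p$, the geometric random composition $\mathbf{C}_{n,p}$ is the random $n$-composition whose terms are independent, with $\mathbb{P}[\mathbf{C}_{n,p}(i)=j]=qp^j$ for every $j\ge0$ and $i\in\{1,\dots,n\}$. (Thus $\omega$ is understood to be such that the displayed expression for $p$ or $q$ is a legitimate value, $p\in[0,1)$.) A component of a composition is a maximal run of consecutive nonzero terms; a gap is a maximal run of consecutive zero terms. $\mathrm{comp}_{\max}(C)$ and $\mathrm{gap}_{\max}(C)$ denote the length of the longest component of $C$ and of the longest gap in $C$ (taken to be $0$ if there is none). $\omega\gg1$ means $\omega(n)\to\infty$ as $n\to\infty$. *)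

theory Defs
  imports "HOL-Probability.Probability"
begin

text \<open>
  An \<open>n\<close>-composition is represented by a function \<open>C :: nat \<Rightarrow> nat\<close> whose terms are
  \<open>C 1, \<dots>, C n\<close>; values outside \<open>{1..n}\<close> are irrelevant.

  Since \<^const>\<open>geometric_pmf\<close> is parametrised by the success probability, it is applied to
  \<open>1 - p\<close>, so that each term takes the value \<open>j\<close> with probability \<open>(1 - p) * p ^ j\<close>.
\<close>

definition random_composition :: "nat \<Rightarrow> real \<Rightarrow> (nat \<Rightarrow> nat) pmf" where
  "random_composition n p = Pi_pmf {1..n} 0 (\<lambda>_. geometric_pmf (1 - p))"

lemma pmf_random_composition_term:
  assumes "0 \<le> p" "p < 1" "i \<in> {1..n}"
  shows "pmf (map_pmf (\<lambda>C. C i) (random_composition n p)) j = (1 - p) * p ^ j"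
  using assms by (simp add: random_composition_def Pi_pmf_component)

lemma indep_vars_random_composition:
  "prob_space.indep_vars (measure_pmf (random_composition n p))
     (\<lambda>_. count_space UNIV) (\<lambda>i C. C i) {1..n}"
  unfolding random_composition_def by (rule indep_vars_Pi_pmf) simp

definition is_run :: "(nat \<Rightarrow> bool) \<Rightarrow> nat \<Rightarrow> (nat \<Rightarrow> nat) \<Rightarrow> nat set \<Rightarrow> bool" where
  "is_run P n C I \<longleftrightarrow>
     (\<exists>a b. a \<le> b \<and> I = {a..b}) \<and> I \<subseteq> {1..n} \<and> (\<forall>i\<in>I. P (C i))"

definition maximal_runs :: "(nat \<Rightarrow> bool) \<Rightarrow> nat \<Rightarrow> (nat \<Rightarrow> nat) \<Rightarrow> nat set set" where
  "maximal_runs P n C =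
     {I. is_run P n C I \<and> (\<forall>J. is_run P n C J \<and> I \<subseteq> J \<longrightarrow> J = I)}"

definition components :: "nat \<Rightarrow> (nat \<Rightarrow> nat) \<Rightarrow> nat set set" where
  "components n C = maximal_runs (\<lambda>x. x \<noteq> 0) n C"

definition gaps :: "nat \<Rightarrow> (nat \<Rightarrow> nat) \<Rightarrow> nat set set" where
  "gaps n C = maximal_runs (\<lambda>x. x = 0) n C"

definition comp_max :: "nat \<Rightarrow> (nat \<Rightarrow> nat) \<Rightarrow> nat" where
  "comp_max n C = Max (insert 0 (card ` components n C))"

definition gap_max :: "nat \<Rightarrow> (nat \<Rightarrow> nat) \<Rightarrow> nat" where
  "gap_max n C = Max (insert 0 (card ` gaps n C))"

lemma finite_maximal_runs: "finite (maximal_runs P n C)"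
  by (rule finite_subset[of _ "Pow {1..n}"]) (auto simp: maximal_runs_def is_run_def)

end

theory Submission
  imports Defs "HOL-Real_Asymp.Real_Asymp"
begin

text \<open>
  Marking the terms of the composition that are nonzero (for components) or zero (for gaps) gives
  \<open>n\<close> independent trials that succeed with probability \<open>1 - r\<close>, where \<open>r = q\<close> for components and
  \<open>r = p\<close> for gaps. The four claims are therefore two claims about the longest success run, and
  this run has length at least \<open>m = \<lceil>k\<rceil>\<close> exactly when some window of \<open>m\<close> consecutive trials
  consists of successes.

  If \<open>r k = ln n + \<omega>\<close>, the union bound over the at most \<open>n\<close> windows bounds the probability by
  \<open>n (1 - r) ^ m \<le> n exp (- r k) = exp (- \<omega>)\<close>, which tends to \<open>0\<close>; see
  \<open>prob_longest_run_ge_upper\<close>.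

  If \<open>r k = (1 - c) ln n - \<omega>\<close>, it suffices to look at \<open>n div m\<close> pairwise disjoint windows. They are
  independent, so all of them fail with probability at most
  \<open>(1 - (1 - r) ^ m) ^ (n div m) \<le> exp (- (n div m) (1 - r) ^ m)\<close>; see
  \<open>prob_longest_run_ge_lower\<close>. Since \<open>r\<close> is of order at most \<open>ln n / k\<close> and \<open>k\<close> is a positive
  power of \<open>n\<close>, both \<open>r\<close> and \<open>k r\<^sup>2\<close> vanish, so that \<open>(1 - r) ^ m\<close> agrees with
  \<open>exp (- r k) = n powr (c - 1) * exp \<omega>\<close> up to a constant factor. There are about
  \<open>n / k = n powr (1 - c)\<close> windows, hence the exponent is of order at least \<open>exp \<omega>\<close> and the
  failure probability tends to \<open>0\<close>. The loss of a factor \<open>k\<close> in the number of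
  windows is what separates the two thresholds \<open>ln n\<close> and \<open>(1 - c) ln n\<close>.
\<close>

section \<open>Long runs and windows of constant length\<close>

text \<open>
  The common form of \<^const>\<open>comp_max\<close> and \<^const>\<open>gap_max\<close>, so that each bound is proved once.
\<close>
definition longest_run :: "(nat \<Rightarrow> bool) \<Rightarrow> nat \<Rightarrow> (nat \<Rightarrow> nat) \<Rightarrow> nat" where
  "longest_run P n C = Max (insert 0 (card ` maximal_runs P n C))"

lemma run_extends_to_maximal_run:
  assumes "is_run P n C I"
  obtains J where "J \<in> maximal_runs P n C" "I \<subseteq> J"
proof -
  have "finite {J. is_run P n C J}"
    by (rule finite_subset[of _ "Pow {1..n}"]) (auto simp: is_run_def)
  from finite_has_maximal2[OF this, of I] assms
  obtain J where "is_run P n C J" "I \<subseteq> J" "\<forall>K\<in>{J. is_run P n C J}. J \<subseteq> K \<longrightarrow> J = K"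
    by auto
  then show ?thesis
    by (intro that[of J]) (auto simp: maximal_runs_def)
qed

text \<open>
  Maximality is eliminated here: a long maximal run contains a window of length \<open>m\<close>, and a window
  lies inside a maximal run. What remains is an event about finitely many fixed sets of positions.
\<close>
lemma longest_run_ge_iff:
  assumes "m \<ge> 1"
  shows "m \<le> longest_run P n C \<longleftrightarrow> (\<exists>a\<in>{1..n}. is_run P n C {a..<a + m})"
proof
  assume "m \<le> longest_run P n C"
  then obtain I where I: "I \<in> maximal_runs P n C" "m \<le> card I"
    using assms by (auto simp: longest_run_def Max_ge_iff finite_maximal_runs)
  then obtain a b where ab: "I = {a..b}" "a \<le> b" "I \<subseteq> {1..n}" "\<forall>i\<in>I. P (C i)"
    by (auto simp: maximal_runs_def is_run_def)
  have sub: "{a..<a + m} \<subseteq> I" and "a \<in> {1..n}"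
    using ab I(2) by auto
  moreover have "{a..<a + m} = {a..a + m - 1}"
    using assms by auto
  ultimately have "is_run P n C {a..<a + m}"
    using ab assms unfolding is_run_def by (metis le_add1 diff_add_assoc subset_iff subset_trans)
  with \<open>a \<in> {1..n}\<close> show "\<exists>a\<in>{1..n}. is_run P n C {a..<a + m}" ..
next
  assume "\<exists>a\<in>{1..n}. is_run P n C {a..<a + m}"
  then obtain a J where J: "J \<in> maximal_runs P n C" "{a..<a + m} \<subseteq> J"
    by (meson run_extends_to_maximal_run)
  have "finite J"
    using J(1) by (auto simp: maximal_runs_def is_run_def)
  from card_mono[OF this J(2)] J(1) show "m \<le> longest_run P n C"
    by (auto simp: longest_run_def Max_ge_iff finite_maximal_runs)
qed

lemma is_run_block_iff:
  assumes "m \<ge> 1" "{a..<a + m} \<subseteq> {1..n}"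
  shows "is_run P n C {a..<a + m} \<longleftrightarrow> (\<forall>i\<in>{a..<a + m}. P (C i))"
proof -
  have "{a..<a + m} = {a..a + m - 1}" "a \<le> a + m - 1"
    using assms(1) by auto
  then show ?thesis
    using assms(2) unfolding is_run_def by metis
qed

section \<open>Bounds for independent trials\<close>

lemma prob_block_Pi_pmf:
  fixes D :: "'a pmf"
  assumes "finite A" "B \<subseteq> A"
  shows "measure_pmf.prob (Pi_pmf A d (\<lambda>_. D)) {C. \<forall>i\<in>B. P (C i)}
           = measure_pmf.prob D {x. P x} ^ card B"
proof -
  have "{C. \<forall>i\<in>B. P (C i)} = Pi A (\<lambda>i. if i \<in> B then {x. P x} else UNIV)"
    using assms(2) by (auto simp: Pi_def)
  then have "measure_pmf.prob (Pi_pmf A d (\<lambda>_. D)) {C. \<forall>i\<in>B. P (C i)}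
      = (\<Prod>i\<in>A. measure_pmf.prob D (if i \<in> B then {x. P x} else UNIV))"
    by (simp add: measure_Pi_pmf_Pi assms(1))
  also have "\<dots> = (\<Prod>i\<in>A. if i \<in> B then measure_pmf.prob D {x. P x} else 1)"
    by (intro prod.cong) auto
  also have "\<dots> = measure_pmf.prob D {x. P x} ^ card B"
    using assms by (simp add: prod.If_cases Int_absorb1)
  finally show ?thesis .
qed

text \<open>
  Disjoint sets of coordinates of a product distribution are independent, and whether the block
  \<open>B j\<close> consists of successes depends only on the restriction of the sample to \<open>B j\<close>.
\<close>
lemma prob_no_block_Pi_pmf:
  fixes D :: "'a pmf"
  assumes "finite A" "finite J" and sub: "\<And>j. j \<in> J \<Longrightarrow> B j \<subseteq> A"
    and disj: "disjoint_family_on B J"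
  shows "measure_pmf.prob (Pi_pmf A d (\<lambda>_. D)) {C. \<forall>j\<in>J. \<not> (\<forall>i\<in>B j. P (C i))}
           = (\<Prod>j\<in>J. 1 - measure_pmf.prob D {x. P x} ^ card (B j))"
proof (cases "J = {}")
  case False
  let ?M = "Pi_pmf A d (\<lambda>_. D)"
  let ?prob = "measure_pmf.prob ?M"
  note prob = measure_pmf.prob_space_axioms[of ?M]
  have all_succeed: "Measurable.pred (PiM (B j) (\<lambda>_. count_space UNIV)) (\<lambda>x. \<forall>i\<in>B j. P (x i))"
    if "j \<in> J" for j
  proof (rule pred_intros_finite(3))
    show "finite (B j)"
      using sub[OF that] \<open>finite A\<close> finite_subset by blast
    show "Measurable.pred (PiM (B j) (\<lambda>_. count_space UNIV)) (\<lambda>x. P (x i))" if "i \<in> B j" for i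
      using that by (intro measurable_compose[OF measurable_component_singleton]) auto
  qed
  have "prob_space.indep_vars ?M (\<lambda>_. count_space UNIV) (\<lambda>i C. C i) A"
    by (rule indep_vars_Pi_pmf) fact
  then have "prob_space.indep_vars ?M (\<lambda>j. PiM (B j) (\<lambda>_. count_space UNIV))
      (\<lambda>j C. restrict (\<lambda>i. C i) (B j)) J"
    using False sub disj by (intro prob_space.indep_vars_restrict[OF prob]) auto
  then have "prob_space.indep_vars ?M (\<lambda>_. count_space UNIV)
      (\<lambda>j C. \<forall>i\<in>B j. P (restrict (\<lambda>i. C i) (B j) i)) J"
    by (rule prob_space.indep_vars_compose2[OF prob]) (rule all_succeed)
  then have "?prob (\<Inter>j\<in>J. (\<lambda>C. \<forall>i\<in>B j. P (restrict (\<lambda>i. C i) (B j) i)) -` {False} \<inter> space ?M)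
      = (\<Prod>j\<in>J. ?prob ((\<lambda>C. \<forall>i\<in>B j. P (restrict (\<lambda>i. C i) (B j) i)) -` {False} \<inter> space ?M))"
    using False \<open>finite J\<close> by (intro prob_space.indep_varsD[OF prob]) auto
  also have "\<dots> = (\<Prod>j\<in>J. ?prob (- {C. \<forall>i\<in>B j. P (C i)}))"
    by (intro prod.cong arg_cong[where f = ?prob]) auto
  also have "\<dots> = (\<Prod>j\<in>J. 1 - measure_pmf.prob D {x. P x} ^ card (B j))"
  proof (intro prod.cong refl)
    fix j assume "j \<in> J"
    show "?prob (- {C. \<forall>i\<in>B j. P (C i)}) = 1 - measure_pmf.prob D {x. P x} ^ card (B j)"
      using measure_pmf.prob_compl[of "{C. \<forall>i\<in>B j. P (C i)}" ?M]
        prob_block_Pi_pmf[OF \<open>finite A\<close> sub[OF \<open>j \<in> J\<close>], of d D P]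
      by (simp add: Compl_eq_Diff_UNIV)
  qed
  also have "(\<Inter>j\<in>J. (\<lambda>C. \<forall>i\<in>B j. P (restrict (\<lambda>i. C i) (B j) i)) -` {False} \<inter> space ?M)
      = {C. \<forall>j\<in>J. \<not> (\<forall>i\<in>B j. P (C i))}"
    using False by auto
  finally show ?thesis .
qed auto

text \<open>
  The union bound over the possible starting positions of a window of successes; positions whose
  window sticks out of \<open>{1..n}\<close> contribute nothing.
\<close>
lemma prob_longest_run_ge_upper:
  assumes "m \<ge> 1"
  shows "measure_pmf.prob (Pi_pmf {1..n} d (\<lambda>_. D)) {C. m \<le> longest_run P n C}
           \<le> real n * measure_pmf.prob D {x. P x} ^ m"
proof -
  let ?M = "Pi_pmf {1..n} d (\<lambda>_. D)" and ?s = "measure_pmf.prob D {x. P x}"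
  have "measure_pmf.prob ?M {C. m \<le> longest_run P n C}
      = measure_pmf.prob ?M (\<Union>a\<in>{1..n}. {C. is_run P n C {a..<a + m}})"
    by (intro arg_cong[where f = "measure_pmf.prob ?M"]) (use longest_run_ge_iff[OF assms] in blast)
  also have "\<dots> \<le> (\<Sum>a\<in>{1..n}. measure_pmf.prob ?M {C. is_run P n C {a..<a + m}})"
    by (rule measure_pmf.finite_measure_subadditive_finite) auto
  also have "\<dots> \<le> (\<Sum>a\<in>{1..n}. ?s ^ m)"
  proof (rule sum_mono)
    fix a
    show "measure_pmf.prob ?M {C. is_run P n C {a..<a + m}} \<le> ?s ^ m"
    proof (cases "{a..<a + m} \<subseteq> {1..n}")
      case True
      then show ?thesis
        using prob_block_Pi_pmf[of "{1..n}" "{a..<a + m}" d D P]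
        by (simp add: is_run_block_iff[OF assms True])
    next
      case False
      then have "{C. is_run P n C {a..<a + m}} = {}"
        by (auto simp: is_run_def)
      then show ?thesis by simp
    qed
  qed
  finally show ?thesis by simp
qed

text \<open>
  Only the \<open>n div m\<close> consecutive disjoint windows starting at \<open>1, m + 1, 2 m + 1, \<dots>\<close> are inspected.
  Ignoring the other windows loses probability, but the inspected ones are independent.
\<close>
lemma prob_longest_run_ge_lower:
  assumes "m \<ge> 1"
  shows "1 - (1 - measure_pmf.prob D {x. P x} ^ m) ^ (n div m)
           \<le> measure_pmf.prob (Pi_pmf {1..n} d (\<lambda>_. D)) {C. m \<le> longest_run P n C}"
proof -
  let ?M = "Pi_pmf {1..n} d (\<lambda>_. D)"
  define B where "B j = {j * m + 1..<j * m + 1 + m}" for j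
  define J where "J = {..<n div m}"
  have sub: "B j \<subseteq> {1..n}" if "j \<in> J" for j
  proof -
    have "Suc j * m \<le> n div m * m"
      using that unfolding J_def by (intro mult_le_mono1) auto
    also have "\<dots> \<le> n" by simp
    finally show ?thesis by (auto simp: B_def)
  qed
  \<comment> \<open>The window that contains a position can be read off from the position.\<close>
  have index: "(i - 1) div m = j" if "i \<in> B j" for i j
    using that by (intro div_nat_eqI) (auto simp: B_def mult.commute)
  have disj: "disjoint_family_on B J"
    unfolding disjoint_family_on_def using index by blast
  have card: "card (B j) = m" for j by (simp add: B_def)
  have "measure_pmf.prob ?M (- {C. m \<le> longest_run P n C})
      \<le> measure_pmf.prob ?M {C. \<forall>j\<in>J. \<not> (\<forall>i\<in>B j. P (C i))}"
  proof (intro measure_pmf.finite_measure_mono subsetI CollectI ballI notI)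
    fix C j assume "C \<in> - {C. m \<le> longest_run P n C}" "j \<in> J" "\<forall>i\<in>B j. P (C i)"
    then have "is_run P n C (B j)"
      using is_run_block_iff[OF assms, of "j * m + 1" n P C] sub[of j] by (simp add: B_def)
    moreover have "j * m + 1 \<in> {1..n}"
      using subsetD[OF sub[OF \<open>j \<in> J\<close>], of "j * m + 1"] assms by (simp add: B_def)
    ultimately have "m \<le> longest_run P n C"
      unfolding longest_run_ge_iff[OF assms] B_def by blast
    with \<open>C \<in> - {C. m \<le> longest_run P n C}\<close> show False by simp
  qed simp
  also have "\<dots> = (1 - measure_pmf.prob D {x. P x} ^ m) ^ (n div m)"
    using prob_no_block_Pi_pmf[OF _ _ sub disj, of d D P] by (simp add: card J_def)
  finally show ?thesis
    using measure_pmf.prob_compl[of "{C. m \<le> longest_run P n C}" ?M]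
    by (simp add: Compl_eq_Diff_UNIV)
qed

section \<open>Asymptotics\<close>

lemma longest_run_prob_tendsto_0:
  fixes k \<omega> r :: "nat \<Rightarrow> real" and D :: "nat \<Rightarrow> nat pmf"
  assumes k: "\<forall>\<^sub>F n in sequentially. 0 < k n"
    and \<omega>: "filterlim \<omega> at_top sequentially"
    and r: "\<And>n. measure_pmf.prob (D n) {x. P x} = 1 - r n"
    and eq: "\<forall>\<^sub>F n in sequentially. r n = (ln (real n) + \<omega> n) / k n"
  shows "(\<lambda>n. measure_pmf.prob (Pi_pmf {1..n} d (\<lambda>_. D n)) {C. k n \<le> real (longest_run P n C)})
           \<longlonglongrightarrow> 0"
proof (rule tendsto_sandwich)
  show "(\<lambda>_. 0) \<longlonglongrightarrow> (0::real)" by simp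
  show "(\<lambda>n. exp (- \<omega> n)) \<longlonglongrightarrow> 0"
    using \<omega> by (intro filterlim_compose[OF exp_at_bot]) (simp add: filterlim_uminus_at_bot)
  show "\<forall>\<^sub>F n in sequentially. measure_pmf.prob (Pi_pmf {1..n} d (\<lambda>_. D n))
      {C. k n \<le> real (longest_run P n C)} \<le> exp (- \<omega> n)"
    using k eq eventually_gt_at_top[of 0]
  proof eventually_elim
    case (elim n)
    define m where "m = nat \<lceil>k n\<rceil>"
    have m: "m \<ge> 1" "k n \<le> real m" and m_iff: "k n \<le> real x \<longleftrightarrow> m \<le> x" for x
      using elim(1) unfolding m_def by linarith+
    have r01: "0 \<le> r n" "r n \<le> 1"
      using r[of n] measure_pmf.prob_le_1[of "D n" "{x. P x}"]
        measure_nonneg[of "measure_pmf (D n)" "{x. P x}"] by linarith+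
    have "(1 - r n) ^ m \<le> exp (- r n) ^ m"
      using r01 exp_ge_add_one_self[of "- r n"] by (intro power_mono) auto
    also have "\<dots> = exp (- (real m * r n))"
      by (simp flip: exp_of_nat_mult)
    also have "\<dots> \<le> exp (- (k n * r n))"
      using m r01 by (simp add: mult_right_mono)
    also have "\<dots> = exp (- \<omega> n) / real n"
      using elim by (simp add: exp_diff exp_minus field_simps)
    finally have "real n * (1 - r n) ^ m \<le> exp (- \<omega> n)"
      using elim(3) by (simp add: field_simps)
    then show ?case
      using prob_longest_run_ge_upper[OF m(1), of n d "D n" P] by (simp add: m_iff r)
  qed
qed simp

text \<open>
  The number of windows times \<open>(1 - r) ^ m\<close> has to tend to infinity. The estimate
  \<open>ln (1 - r) \<ge> - r - 2 r\<^sup>2\<close> and rounding \<open>k\<close> up to \<open>m \<le> k + 1\<close> cost at most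
  \<open>r + 2 (k + 1) r\<^sup>2 \<le> r + 4 k r\<^sup>2\<close> in the exponent, and rounding \<open>n / m\<close> down costs a constant factor;
  altogether the product is eventually at least \<open>exp (\<omega> - 1) / 4\<close>.
\<close>
lemma longest_run_prob_tendsto_1:
  fixes c :: real and k \<omega> r :: "nat \<Rightarrow> real" and D :: "nat \<Rightarrow> nat pmf"
  assumes c: "0 < c" "c < 1" and k: "\<And>n. k n = real n powr c"
    and \<omega>: "filterlim \<omega> at_top sequentially"
    and r: "\<And>n. measure_pmf.prob (D n) {x. P x} = 1 - r n"
    and eq: "\<forall>\<^sub>F n in sequentially. r n = ((1 - c) * ln (real n) - \<omega> n) / k n"
  shows "(\<lambda>n. measure_pmf.prob (Pi_pmf {1..n} d (\<lambda>_. D n)) {C. k n \<le> real (longest_run P n C)})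
           \<longlonglongrightarrow> 1"
proof (rule tendsto_sandwich)
  have "LIM n sequentially. exp (\<omega> n - 1) / 4 :> at_top"
    by (rule filterlim_compose[OF _ \<omega>]) real_asymp
  then have "(\<lambda>n. exp (- (exp (\<omega> n - 1) / 4))) \<longlonglongrightarrow> 0"
    by (intro filterlim_compose[OF exp_at_bot]) (simp only: filterlim_uminus_at_bot minus_minus)
  from tendsto_diff[OF tendsto_const[of 1] this]
  show "(\<lambda>n. 1 - exp (- (exp (\<omega> n - 1) / 4))) \<longlonglongrightarrow> 1"
    by simp
  show "(\<lambda>_. 1) \<longlonglongrightarrow> (1::real)" by simp
  \<comment> \<open>With \<open>r\<close> replaced by its upper bound \<open>ln n / k\<close>, \<open>half\<close> admits the estimate of \<open>ln (1 - r)\<close> and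
    \<open>err\<close> bounds the total error in the exponent; \<open>k4\<close> absorbs the rounding of \<open>n / m\<close>.\<close>
  have k1: "\<forall>\<^sub>F n in sequentially. 1 \<le> real n powr c"
    using c by real_asymp
  have k4: "\<forall>\<^sub>F n in sequentially. 4 * real n powr c \<le> real n"
    using c by real_asymp
  have half: "\<forall>\<^sub>F n in sequentially. ln (real n) / real n powr c \<le> 1 / 2"
    using c by real_asymp
  have err: "\<forall>\<^sub>F n in sequentially. ln (real n) / real n powr c
      + 4 * real n powr c * (ln (real n) / real n powr c)\<^sup>2 \<le> 1"
    using c by real_asymp
  have \<omega>0: "\<forall>\<^sub>F n in sequentially. 0 \<le> \<omega> n"
    using \<omega> by (simp add: filterlim_at_top)
  show "\<forall>\<^sub>F n in sequentially. 1 - exp (- (exp (\<omega> n - 1) / 4))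
      \<le> measure_pmf.prob (Pi_pmf {1..n} d (\<lambda>_. D n)) {C. k n \<le> real (longest_run P n C)}"
    using k1 k4 half err \<omega>0 eq eventually_gt_at_top[of 0]
  proof eventually_elim
    case (elim n)
    note [simp] = k[of n, symmetric]
    define m where "m = nat \<lceil>k n\<rceil>"
    have k_ge: "1 \<le> k n" and k_le: "4 * k n \<le> real n" using elim by simp_all
    have m: "m \<ge> 1" "real m \<le> k n + 1" and m_iff: "k n \<le> real x \<longleftrightarrow> m \<le> x" for x
      using k_ge unfolding m_def by linarith+
    define s where "s = 1 - r n"
    have r0: "0 \<le> r n" and s01: "0 \<le> s" "s \<le> 1"
      using r[of n] measure_pmf.prob_le_1[of "D n" "{x. P x}"]
        measure_nonneg[of "measure_pmf (D n)" "{x. P x}"] unfolding s_def by linarith+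
    have ln0: "0 \<le> ln (real n)" using elim by simp
    have "k n * r n = (1 - c) * ln (real n) - \<omega> n"
      using elim k_ge by simp
    have "(1 - c) * ln (real n) - \<omega> n \<le> ln (real n)"
      using c ln0 elim by (simp add: algebra_simps add_increasing)
    then have r_le: "r n \<le> ln (real n) / k n"
      using elim k_ge by (simp add: divide_right_mono)
    have r_half: "r n \<le> 1 / 2" using r_le elim(3) unfolding k by linarith
    have "r n + 4 * k n * (r n)\<^sup>2 \<le> ln (real n) / k n + 4 * k n * (ln (real n) / k n)\<^sup>2"
      using r_le k_ge power_mono[OF r_le r0, of 2] by (intro add_mono mult_left_mono) auto
    also have "\<dots> \<le> 1" using elim by simp
    finally have err1: "r n + 4 * k n * (r n)\<^sup>2 \<le> 1" .
    have "real m * (r n + 2 * (r n)\<^sup>2) \<le> (k n + 1) * (r n + 2 * (r n)\<^sup>2)"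
      using m r0 by (intro mult_right_mono) auto
    also have "\<dots> = k n * r n + r n + 2 * (k n + 1) * (r n)\<^sup>2"
      by (simp add: algebra_simps)
    also have "\<dots> \<le> k n * r n + r n + (4 * k n) * (r n)\<^sup>2"
      using k_ge r0 by (intro add_mono mult_right_mono) auto
    also have "\<dots> \<le> (1 - c) * ln (real n) - \<omega> n + 1"
      using err1 \<open>k n * r n = _\<close> by simp
    finally have expo: "real m * (r n + 2 * (r n)\<^sup>2) \<le> (1 - c) * ln (real n) - \<omega> n + 1" .
    have "exp (\<omega> n - 1) * (k n / real n) = exp (- ((1 - c) * ln (real n) - \<omega> n + 1))"
      using elim(7) unfolding k by (simp add: powr_def exp_diff exp_minus exp_add algebra_simps field_simps)
    also have "\<dots> \<le> exp (real m * (- r n - 2 * (r n)\<^sup>2))"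
      using expo by (simp add: algebra_simps)
    also have "\<dots> \<le> exp (real m * ln s)"
      unfolding s_def
      using ln_one_minus_pos_lower_bound[OF r0 r_half] by (simp add: mult_left_mono)
    also have "\<dots> = s ^ m"
      using r_half by (simp add: exp_of_nat_mult s_def)
    finally have sm: "exp (\<omega> n - 1) * (k n / real n) \<le> s ^ m" .
    \<comment> \<open>There are at least \<open>n / (4 k)\<close> windows: \<open>m \<le> 2 k\<close>, and the \<open>1\<close> lost by rounding down is at
      most half of \<open>n / (2 k)\<close>.\<close>
    have "real n / (4 * k n) \<le> real n / (2 * k n) - 1"
      using k_ge k_le by (simp add: field_simps)
    also have "real n / (2 * k n) \<le> real n / real m"
      using k_ge m by (intro divide_left_mono) auto
    also have "real n / real m - 1 \<le> real (n div m)"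
      using real_of_int_floor_gt_diff_one[of "real n / real m"]
      by (simp add: floor_divide_of_nat_eq)
    finally have N: "real n / (4 * k n) \<le> real (n div m)" by simp
    have "exp (\<omega> n - 1) / 4 = real n / (4 * k n) * (exp (\<omega> n - 1) * (k n / real n))"
      using k_ge elim(7) by (simp add: field_simps)
    also have "\<dots> \<le> real (n div m) * s ^ m"
      using N sm k_ge by (intro mult_mono) auto
    finally have Ns: "exp (\<omega> n - 1) / 4 \<le> real (n div m) * s ^ m" .
    have "(1 - s ^ m) ^ (n div m) \<le> exp (- (s ^ m)) ^ (n div m)"
      using s01 exp_ge_add_one_self[of "- (s ^ m)"] by (intro power_mono) (auto simp: power_le_one)
    also have "\<dots> = exp (- (real (n div m) * s ^ m))"
      by (simp flip: exp_of_nat_mult)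
    also have "\<dots> \<le> exp (- (exp (\<omega> n - 1) / 4))"
      using Ns by simp
    finally show ?case
      using prob_longest_run_ge_lower[OF m(1), of "D n" P n d] by (simp add: m_iff r s_def)
  qed
qed simp

section \<open>Components and gaps of geometric compositions\<close>

lemma comp_max_eq_longest_run: "comp_max n C = longest_run (\<lambda>x. x \<noteq> 0) n C"
  by (simp add: comp_max_def components_def longest_run_def)

lemma gap_max_eq_longest_run: "gap_max n C = longest_run (\<lambda>x. x = 0) n C"
  by (simp add: gap_max_def gaps_def longest_run_def)

lemma prob_geometric_eq_0:
  assumes "0 \<le> p" "p < 1"
  shows "measure_pmf.prob (geometric_pmf (1 - p)) {x. x = 0} = 1 - p"
  using assms by (simp add: measure_pmf_single)

lemma prob_geometric_neq_0:
  assumes "0 \<le> p" "p < 1"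
  shows "measure_pmf.prob (geometric_pmf (1 - p)) {x. x \<noteq> 0} = p"
proof -
  have "{x::nat. x \<noteq> 0} = UNIV - {x. x = 0}" by auto
  then show ?thesis
    using measure_pmf.prob_compl[of "{x. x = 0}" "geometric_pmf (1 - p)"]
      prob_geometric_eq_0[OF assms] by simp
qed

theorem proposition3p6:
  fixes c :: real and k \<omega> p q :: "nat \<Rightarrow> real"
  assumes "0 < c" and "c < 1"
    and "\<And>n. k n = real n powr c"
    and "filterlim \<omega> at_top sequentially"
    and "\<And>n. 0 \<le> p n \<and> p n < 1"
    and "\<And>n. q n = 1 - p n"
  shows
    "((\<forall>\<^sub>F n in sequentially. q n = (ln (real n) + \<omega> n) / k n) \<longrightarrow>
        (\<lambda>n. measure_pmf.prob (random_composition n (p n)) {C. real (comp_max n C) \<ge> k n})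
          \<longlonglongrightarrow> 0) \<and>
     ((\<forall>\<^sub>F n in sequentially. q n = ((1 - c) * ln (real n) - \<omega> n) / k n) \<longrightarrow>
        (\<lambda>n. measure_pmf.prob (random_composition n (p n)) {C. real (comp_max n C) \<ge> k n})
          \<longlonglongrightarrow> 1) \<and>
     ((\<forall>\<^sub>F n in sequentially. p n = ((1 - c) * ln (real n) - \<omega> n) / k n) \<longrightarrow>
        (\<lambda>n. measure_pmf.prob (random_composition n (p n)) {C. real (gap_max n C) \<ge> k n})
          \<longlonglongrightarrow> 1) \<and>
     ((\<forall>\<^sub>F n in sequentially. p n = (ln (real n) + \<omega> n) / k n) \<longrightarrow>
        (\<lambda>n. measure_pmf.prob (random_composition n (p n)) {C. real (gap_max n C) \<ge> k n})
          \<longlonglongrightarrow> 0)"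
proof (intro conjI impI)
  have k_pos: "\<forall>\<^sub>F n in sequentially. 0 < k n"
    using eventually_gt_at_top[of 0] by eventually_elim (simp add: assms(3))
  have nonzero: "measure_pmf.prob (geometric_pmf (1 - p n)) {x. x \<noteq> 0} = 1 - q n" for n
    using prob_geometric_neq_0[of "p n"] assms(5)[of n] assms(6)[of n] by simp
  have zero: "measure_pmf.prob (geometric_pmf (1 - p n)) {x. x = 0} = 1 - p n" for n
    using prob_geometric_eq_0[of "p n"] assms(5)[of n] by simp
  note unfolds = random_composition_def comp_max_eq_longest_run gap_max_eq_longest_run
  show "(\<lambda>n. measure_pmf.prob (random_composition n (p n)) {C. real (comp_max n C) \<ge> k n})
      \<longlonglongrightarrow> 0" if "\<forall>\<^sub>F n in sequentially. q n = (ln (real n) + \<omega> n) / k n"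
    unfolding unfolds by (rule longest_run_prob_tendsto_0[OF k_pos assms(4) nonzero that])
  show "(\<lambda>n. measure_pmf.prob (random_composition n (p n)) {C. real (comp_max n C) \<ge> k n})
      \<longlonglongrightarrow> 1" if "\<forall>\<^sub>F n in sequentially. q n = ((1 - c) * ln (real n) - \<omega> n) / k n"
    unfolding unfolds by (rule longest_run_prob_tendsto_1[OF assms(1-4) nonzero that])
  show "(\<lambda>n. measure_pmf.prob (random_composition n (p n)) {C. real (gap_max n C) \<ge> k n})
      \<longlonglongrightarrow> 1" if "\<forall>\<^sub>F n in sequentially. p n = ((1 - c) * ln (real n) - \<omega> n) / k n"
    unfolding unfolds by (rule longest_run_prob_tendsto_1[OF assms(1-4) zero that])
  show "(\<lambda>n. measure_pmf.prob (random_composition n (p n)) {C. real (gap_max n C) \<ge> k n})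
      \<longlonglongrightarrow> 0" if "\<forall>\<^sub>F n in sequentially. p n = (ln (real n) + \<omega> n) / k n"
    unfolding unfolds by (rule longest_run_prob_tendsto_0[OF k_pos assms(4) zero that])
qed

end
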